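(* Every Suslinian plane continuum $X\subset\mathbb R^2$ is contained in a locally connected Suslinian plane continuum $X'\subset\mathbb R^2$.
   Context: A continuum is a compact connected metric space. A space is Suslinian if every collection of pairwise disjoint non-degenerate subcontinua of it is countable. *)

theory Defs
  imports "HOL-Analysis.Analysis"
begin

definition continuum :: "'a::metric_space set \<Rightarrow> bool" where
  "continuum X \<longleftrightarrow> X \<noteq> {} \<and> compact X \<and> connected X"

definition nondegenerate :: "'a set \<Rightarrow> bool" where
  "nondegenerate C \<longleftrightarrow> (\<exists>x\<in>C. \<exists>y\<in>C. x \<noteq> y)"

definition suslinian :: "'a::metric_space set \<Rightarrow> bool" where
  "suslinian X \<longleftrightarrow>
     (\<forall>\<F>. (\<forall>C\<in>\<F>. C \<subseteq> X \<and> continuum C \<and> nondegenerate C) \<and> pairwise disjnt \<F>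
           \<longrightarrow> countable \<F>)"

end

theory Submission
  imports Defs
begin

text \<open>
  Choose finite \<open>2\<^sup>-\<^sup>n\<close>-nets \<open>P n\<close> of \<open>X\<close>, join every point of \<open>P (n + 1)\<close> by a segment to a
  nearby point of \<open>P n\<close>, and let \<open>X'\<close> be the union of \<open>X\<close> with all these segments. The segments
  shrink towards \<open>X\<close>, so \<open>X'\<close> is compact. For every \<open>n\<close>, it is the union of the finitely many
  segments issuing from \<open>P 1, \<dots>, P n\<close> and the closures of the finitely many trees of segments
  descending from the points of \<open>P n\<close>; these trees are connected and small, which yields local
  connectedness. Finally, a countable union of closed Suslinian sets is Suslinian, because by
  the Baire category theorem every nondegenerate continuum in the union has a nondegenerate
  subcontinuum in one of the sets.
\<close>

section \<open>Countable unions of closed Suslinian sets\<close>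

text \<open>By Baire, some \<open>C \<inter> A\<close> has nonempty interior relative to
  \<open>C\<close>. In a compact connected Hausdorff space every open neighbourhood of a point
  contains a continuum larger than that point, so \<open>D\<close> is found inside this
  interior.\<close>

lemma nondegenerate_subcontinuum_of_countable_closed_cover:
  fixes C :: "'a::metric_space set"
  assumes "continuum C" "nondegenerate C" "countable \<A>" "\<And>A. A \<in> \<A> \<Longrightarrow> closed A" "C \<subseteq> \<Union>\<A>"
  obtains A D where "A \<in> \<A>" "D \<subseteq> A" "D \<subseteq> C" "continuum D" "nondegenerate D"
proof -
  let ?T = "top_of_set C"
  have C: "C \<noteq> {}" "compact C" "connected C"
    using assms(1) by (auto simp: continuum_def)
  have H: "Hausdorff_space ?T"
    using Hausdorff_space_subtopology Hausdorff_space_euclidean by blast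
  have K: "compact_space ?T"
    using C by (simp add: compact_space_subtopology)
  have L: "locally_compact_space ?T"
    using K by (simp add: compact_imp_locally_compact_space)
  have "\<exists>A\<in>\<A>. ?T interior_of (C \<inter> A) \<noteq> {}"
  proof (rule ccontr)
    assume "\<not> ?thesis"
    then have "?T interior_of (\<Union>A\<in>\<A>. C \<inter> A) = {}"
      using assms H K L
      by (intro Baire_category_alt)
        (auto simp: compact_Hausdorff_imp_regular_space closedin_closed_Int)
    moreover have "(\<Union>A\<in>\<A>. C \<inter> A) = topspace ?T"
      using assms by auto
    ultimately show False
      using C by (metis interior_of_topspace topspace_euclidean_subtopology)
  qed
  then obtain A p where A: "A \<in> \<A>" and p: "p \<in> ?T interior_of (C \<inter> A)"
    by blast
  have "p \<in> C"
    using p interior_of_subset_topspace[of ?T "C \<inter> A"] by auto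
  \<comment> \<open>\<open>D\<close> lies strictly between the continuum \<open>{p}\<close> and an
    open set around \<open>p\<close>; the strict inclusion of \<open>{p}\<close> makes
    \<open>D\<close> nondegenerate.\<close>
  obtain D where D: "compactin ?T D" "connectedin ?T D" "{p} \<subset> D"
    "D \<subset> ?T interior_of (C \<inter> A)"
  proof (rule intermediate_continuum_exists[of ?T "{p}" "?T interior_of (C \<inter> A)"])
    show "{p} \<noteq> topspace ?T"
      using assms(2) by (auto simp: nondegenerate_def)
  qed (use H L C p \<open>p \<in> C\<close> in \<open>auto simp: connected_space_subconnected
        connectedin_subtopology connected_space_subtopology\<close>)
  have "D \<subseteq> C \<inter> A"
    using D(4) interior_of_subset[of ?T "C \<inter> A"] by blast
  moreover have "continuum D"
    using D by (auto simp: continuum_def compactin_subtopology connectedin_subtopology)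
  moreover have "nondegenerate D"
    using D(3) by (auto simp: nondegenerate_def)
  ultimately show ?thesis
    using A that by blast
qed

text \<open>Each member \<open>C\<close> of a disjoint family is assigned a nondegenerate
  subcontinuum \<open>D C\<close> inside a single \<open>A C\<close>. For a fixed value
  \<open>B\<close> of \<open>A C\<close> the sets \<open>D C\<close> form a disjoint family in the
  Suslinian set \<open>B\<close>, so the family splits into countably many countable
  classes.\<close>

lemma suslinian_countable_Union:
  fixes \<A> :: "'a::metric_space set set"
  assumes "countable \<A>" "\<And>A. A \<in> \<A> \<Longrightarrow> closed A" "\<And>A. A \<in> \<A> \<Longrightarrow> suslinian A"
  shows "suslinian (\<Union>\<A>)"
  unfolding suslinian_def
proof (intro allI impI, elim conjE)
  fix \<F> :: "'a set set"
  assume \<F>: "\<forall>C\<in>\<F>. C \<subseteq> \<Union>\<A> \<and> continuum C \<and> nondegenerate C" and disj: "pairwise disjnt \<F>"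
  have "\<forall>C\<in>\<F>. \<exists>A D. A \<in> \<A> \<and> D \<subseteq> A \<and> D \<subseteq> C \<and> continuum D \<and> nondegenerate D"
    using \<F> assms by (metis nondegenerate_subcontinuum_of_countable_closed_cover)
  then obtain A D where AD: "\<And>C. C \<in> \<F> \<Longrightarrow> A C \<in> \<A> \<and> D C \<subseteq> A C \<and> D C \<subseteq> C
      \<and> continuum (D C) \<and> nondegenerate (D C)"
    by metis
  have "countable {C\<in>\<F>. A C = B}" if "B \<in> \<A>" for B
  proof (rule countable_image_inj_on)
    \<comment> \<open>Since \<open>D C\<close> lies in \<open>C\<close>, members with intersecting
      choices intersect and hence coincide. This gives both disjointness of the choices and
      injectivity of \<open>D\<close>.\<close>
    have *: "C = C'" if "C \<in> \<F>" "C' \<in> \<F>" "\<not> disjnt (D C) (D C')" for C C'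
      using that AD disj by (meson disjnt_subset1 disjnt_subset2 pairwiseD)
    have "pairwise disjnt (D ` {C\<in>\<F>. A C = B})"
      using * by (auto simp: pairwise_def)
    moreover have "\<forall>E\<in>D ` {C\<in>\<F>. A C = B}. E \<subseteq> B \<and> continuum E \<and> nondegenerate E"
      using AD by auto
    ultimately show "countable (D ` {C\<in>\<F>. A C = B})"
      using assms(3)[OF that] by (simp add: suslinian_def)
    show "inj_on D {C\<in>\<F>. A C = B}"
    proof (rule inj_onI)
      fix C C' assume "C \<in> {C\<in>\<F>. A C = B}" "C' \<in> {C\<in>\<F>. A C = B}" "D C = D C'"
      moreover from this have "D C \<noteq> {}"
        using AD by (auto simp: continuum_def)
      ultimately show "C = C'"
        using * by (auto simp: disjnt_def)
    qed
  qed
  then have "countable (\<Union>B\<in>\<A>. {C\<in>\<F>. A C = B})"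
    using assms(1) by blast
  moreover have "\<F> \<subseteq> (\<Union>B\<in>\<A>. {C\<in>\<F>. A C = B})"
    using AD by auto
  ultimately show "countable \<F>"
    by (rule countable_subset[rotated])
qed

section \<open>Segments are Suslinian\<close>

text \<open>Preimages under the affine parametrisation \<open>g\<close> of the line turn disjoint
  nondegenerate continua into disjoint subsets of the reals with nonempty interior, and any such
  family is countable.\<close>

lemma suslinian_closed_segment:
  fixes a b :: "'a::euclidean_space"
  shows "suslinian (closed_segment a b)"
  unfolding suslinian_def
proof (intro allI impI, elim conjE)
  fix \<F> :: "'a set set"
  assume \<F>: "\<forall>C\<in>\<F>. C \<subseteq> closed_segment a b \<and> continuum C \<and> nondegenerate C"
    and disj: "pairwise disjnt \<F>"
  define g where "g t = a + t *\<^sub>R (b - a)" for t :: real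
  have seg: "closed_segment a b = g ` {0..1}"
    by (auto simp: g_def closed_segment_image_interval algebra_simps)
  have int: "interior (g -` C) \<noteq> {}" if C: "C \<in> \<F>" for C
  proof -
    obtain x y where xy: "x \<in> C" "y \<in> C" "x \<noteq> y"
      using \<F> C unfolding nondegenerate_def by blast
    have "collinear C"
      using \<F> C collinear_closed_segment collinear_subset by blast
    then have "convex C"
      using \<F> C convex_connected_collinear by (auto simp: continuum_def)
    have "x \<in> g ` {0..1}" "y \<in> g ` {0..1}"
      using xy \<F> C seg by blast+
    then obtain s' t' where "x = g s'" "y = g t'"
      by blast
    with xy have "g s' \<in> C" "g t' \<in> C" "s' \<noteq> t'"
      by auto
    then have "\<exists>s t. s < t \<and> g s \<in> C \<and> g t \<in> C"
      using linorder_neqE[of s' t'] by metis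
    then obtain s t where st: "s < t" "g s \<in> C" "g t \<in> C"
      by blast
    have "{s..t} \<subseteq> g -` C"
    proof
      fix u assume "u \<in> {s..t}"
      then have "u \<in> closed_segment s t"
        using st(1) by (simp add: closed_segment_eq_real_ivl)
      then obtain v where v: "0 \<le> v" "v \<le> 1" "u = (1 - v) * s + v * t"
        by (auto simp: in_segment)
      have "g u = (1 - v) *\<^sub>R g s + v *\<^sub>R g t"
        by (simp add: g_def v(3) algebra_simps)
      then show "u \<in> g -` C"
        using \<open>convex C\<close> st v by (simp add: convex_alt)
    qed
    then have "interior {s..t} \<subseteq> interior (g -` C)"
      by (rule interior_mono)
    moreover have "interior {s..t} \<noteq> {}"
      using st(1) by simp
    ultimately show ?thesis
      by blast
  qed
  show "countable \<F>"
  proof (rule countable_image_inj_on)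
    have *: "C = C'" if "C \<in> \<F>" "C' \<in> \<F>" "\<not> disjnt (g -` C) (g -` C')" for C C'
      using that disj unfolding pairwise_def disjnt_def by blast
    have "pairwise disjnt ((-`) g ` \<F>)"
      using * by (auto simp: pairwise_def)
    then show "countable ((-`) g ` \<F>)"
      by (rule countable_disjoint_nonempty_interior_subsets) (use int in auto)
    show "inj_on ((-`) g) \<F>"
    proof (rule inj_onI)
      fix C C' assume "C \<in> \<F>" "C' \<in> \<F>" "g -` C = g -` C'"
      moreover from this have "g -` C \<noteq> {}"
        using int by fastforce
      ultimately show "C = C'"
        using * by (auto simp: disjnt_def)
    qed
  qed
qed

section \<open>A criterion for local connectedness\<close>

text \<open>Near \<open>x\<close> only the members containing \<open>x\<close> matter, so each
  nearby point shares a member with \<open>x\<close>. A small connected member joins the two points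
  directly; a convex one may be long, but the segment between the points stays in the ball. It
  suffices to check connectedness im kleinen.\<close>

lemma locally_connected_finite_closed_covers:
  fixes S :: "'a::real_normed_vector set"
  assumes "\<And>e. e > 0 \<Longrightarrow> \<exists>\<A>. finite \<A> \<and> \<Union>\<A> = S \<and>
    (\<forall>A\<in>\<A>. closed A \<and> (convex A \<or> connected A \<and> (\<forall>x\<in>A. \<forall>y\<in>A. dist x y < e)))"
  shows "locally connected S"
  unfolding locally_connected_im_kleinen
proof (intro allI impI, elim conjE)
  fix v x assume v: "openin (top_of_set S) v" "x \<in> v"
  then obtain e where e: "e > 0" "ball x e \<inter> S \<subseteq> v"
    by (meson openin_contains_ball)
  obtain \<A> where \<A>: "finite \<A>" "\<Union>\<A> = S" "\<And>A. A \<in> \<A> \<Longrightarrow> closed A"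
    "\<And>A. A \<in> \<A> \<Longrightarrow> convex A \<or> connected A \<and> (\<forall>x\<in>A. \<forall>y\<in>A. dist x y < e)"
    using assms[OF e(1)] by metis
  \<comment> \<open>Deleting the finitely many closed members that miss \<open>x\<close> leaves an
    open neighbourhood of \<open>x\<close>.\<close>
  define W where "W = ball x e - \<Union>{A\<in>\<A>. x \<notin> A}"
  have "open W"
    unfolding W_def using \<A> by (intro open_Diff closed_Union) auto
  have "\<exists>c. connected c \<and> c \<subseteq> v \<and> x \<in> c \<and> y \<in> c" if y: "y \<in> S \<inter> W" for y
  proof -
    obtain A where A: "A \<in> \<A>" "x \<in> A" "y \<in> A"
      using y \<A>(2) unfolding W_def by blast
    from \<A>(4)[OF A(1)] show ?thesis
    proof
      assume "convex A"
      moreover have "closed_segment x y \<subseteq> ball x e"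
        using y e(1) by (intro closed_segment_subset) (auto simp: W_def)
      ultimately have "closed_segment x y \<subseteq> v"
        using e(2) A \<A>(2) by (meson Int_greatest Sup_upper closed_segment_subset subset_trans)
      then show ?thesis
        by (intro exI[of _ "closed_segment x y"]) auto
    next
      assume "connected A \<and> (\<forall>x\<in>A. \<forall>y\<in>A. dist x y < e)"
      then have "A \<subseteq> v"
        using e(2) A \<A>(2) by auto
      then show ?thesis
        using A \<open>connected A \<and> _\<close> by blast
    qed
  qed
  moreover have "x \<in> S \<inter> W"
    using v e(1) by (auto simp: W_def dest: openin_imp_subset)
  moreover have "S \<inter> W \<subseteq> v"
    using e(2) by (auto simp: W_def)
  ultimately show "\<exists>u. openin (top_of_set S) u \<and> x \<in> u \<and> u \<subseteq> v \<and>
      (\<forall>y. y \<in> u \<longrightarrow> (\<exists>c. connected c \<and> c \<subseteq> v \<and> x \<in> c \<and> y \<in> c))"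
    using \<open>open W\<close> openin_open_Int by (intro exI[of _ "S \<inter> W"]) auto
qed

section \<open>Nets, segments and trees\<close>

text \<open>\<open>P n\<close> is a finite net at scale \<open>(1/2) ^ n\<close>. On points of
  \<open>P (Suc n)\<close> the map \<open>r n\<close> serves as the parent map of the trees; on
  arbitrary points of \<open>X\<close> it supplies approximations from the nets.\<close>

locale nested_nets =
  fixes X :: "'a::euclidean_space set" and P :: "nat \<Rightarrow> 'a set" and r :: "nat \<Rightarrow> 'a \<Rightarrow> 'a"
  assumes compact_X: "compact X" and nonempty_X: "X \<noteq> {}"
    and finite_P: "\<And>n. finite (P n)" and P_subset: "\<And>n. P n \<subseteq> X"
    and r_in: "\<And>n x. x \<in> X \<Longrightarrow> r n x \<in> P n"
    and dist_r: "\<And>n x. x \<in> X \<Longrightarrow> dist x (r n x) \<le> (1/2) ^ n"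
begin

definition segs :: "nat \<Rightarrow> 'a set set" where
  "segs n = (\<lambda>q. closed_segment q (r n q)) ` P (Suc n)"

definition hull_X :: "'a set" where
  "hull_X = X \<union> \<Union>(\<Union>n. segs n)"

text \<open>The part of depth \<open>m\<close> of the tree of segments that descends from the point \<open>p\<close> of \<open>P n\<close>.\<close>

fun tree :: "nat \<Rightarrow> nat \<Rightarrow> 'a \<Rightarrow> 'a set" where
  "tree 0 n p = {p}"
| "tree (Suc m) n p =
    {p} \<union> (\<Union>q\<in>{q\<in>P (Suc n). r n q = p}. closed_segment q p \<union> tree m (Suc n) q)"

lemma finite_segs: "finite (segs n)"
  by (simp add: segs_def finite_P)

lemma closed_segs: "A \<in> segs n \<Longrightarrow> closed A"
  by (auto simp: segs_def)

lemma closed_X: "closed X"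
  using compact_X compact_imp_closed by blast

lemma root_in_tree: "p \<in> tree m n p"
  by (cases m) auto

lemma connected_tree: "connected (tree m n p)"
proof (induction m arbitrary: n p)
  case (Suc m)
  let ?B = "\<lambda>q. closed_segment q p \<union> tree m (Suc n) q"
  have "connected (?B q)" for q
    using Suc root_in_tree[of q m "Suc n"] by (intro connected_Un) auto
  then have "connected (\<Union>(insert {p} (?B ` {q\<in>P (Suc n). r n q = p})))"
    by (intro connected_Union) auto
  then show ?case by simp
qed simp

text \<open>Edge lengths along a descending path are bounded by a geometric series with sum
  \<open>2 * (1/2) ^ n\<close>. The bound is independent of the depth \<open>m\<close>, so it
  survives the union over all depths.\<close>

lemma tree_subset_cball:
  "p \<in> X \<Longrightarrow> tree m n p \<subseteq> cball p (2 * (1/2) ^ n)"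
proof (induction m arbitrary: n p)
  case (Suc m)
  have "closed_segment q p \<union> tree m (Suc n) q \<subseteq> cball p (2 * (1/2) ^ n)"
    if q: "q \<in> P (Suc n)" "r n q = p" for q
  proof -
    have qX: "q \<in> X" using q P_subset by blast
    have d: "dist p q \<le> (1/2) ^ n"
      using dist_r[OF qX, of n] q by (simp add: dist_commute)
    have "tree m (Suc n) q \<subseteq> cball q ((1/2) ^ n)"
      using Suc.IH[OF qX, of "Suc n"] by simp
    also have "\<dots> \<subseteq> cball p (2 * (1/2) ^ n)"
    proof
      fix z assume "z \<in> cball q ((1/2) ^ n)"
      then show "z \<in> cball p (2 * (1/2) ^ n)"
        using d dist_triangle[of p z q] by auto
    qed
    finally have "tree m (Suc n) q \<subseteq> cball p (2 * (1/2) ^ n)" .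
    moreover have "closed_segment q p \<subseteq> cball p (2 * (1/2) ^ n)"
    proof (rule closed_segment_subset)
      have "(1/2::real) ^ n \<ge> 0" by simp
      then show "q \<in> cball p (2 * (1/2) ^ n)"
        using d unfolding mem_cball by linarith
    qed auto
    ultimately show ?thesis by blast
  qed
  then show ?case by auto
qed simp

lemma tree_subset_hull: "p \<in> X \<Longrightarrow> tree m n p \<subseteq> hull_X"
proof (induction m arbitrary: n p)
  case (Suc m)
  have "closed_segment q p \<subseteq> hull_X" "tree m (Suc n) q \<subseteq> hull_X"
    if "q \<in> P (Suc n)" "r n q = p" for q
    using that Suc.IH[of q "Suc n"] P_subset by (auto simp: hull_X_def segs_def)
  then show ?case using Suc.prems by (auto simp: hull_X_def)
qed (auto simp: hull_X_def)

text \<open>Following parents from the coarser end of the segment for \<open>m\<close> levels leads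
  to a root in \<open>P n\<close>; the segment itself accounts for the additional level in the depth
  \<open>Suc m\<close>.\<close>

lemma segs_subset_trees: "A \<in> segs (m + n) \<Longrightarrow> A \<subseteq> (\<Union>p\<in>P n. tree (Suc m) n p)"
proof (induction m arbitrary: n)
  case 0
  then obtain q where q: "q \<in> P (Suc n)" "A = closed_segment q (r n q)"
    by (auto simp: segs_def)
  moreover from q have "r n q \<in> P n"
    using P_subset r_in by blast
  ultimately show ?case by auto
next
  case (Suc m)
  have "tree (Suc m) (Suc n) q \<subseteq> (\<Union>p\<in>P n. tree (Suc (Suc m)) n p)" if "q \<in> P (Suc n)" for q
  proof -
    have "r n q \<in> P n"
      using that P_subset r_in by blast
    moreover have "tree (Suc m) (Suc n) q \<subseteq> tree (Suc (Suc m)) n (r n q)"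
      using that by (subst (2) tree.simps) blast
    ultimately show ?thesis by blast
  qed
  note step = this
  have "A \<in> segs (m + Suc n)"
    using Suc.prems by simp
  then have "A \<subseteq> (\<Union>q\<in>P (Suc n). tree (Suc m) (Suc n) q)"
    by (rule Suc.IH)
  also have "\<dots> \<subseteq> (\<Union>p\<in>P n. tree (Suc (Suc m)) n p)"
    by (rule UN_least) (rule step)
  finally show ?case .
qed

section \<open>Topology of the enlarged set\<close>

text \<open>The set is the intersection of the closed sets \<open>?K n\<close>, each made of
  finitely many segments and the closed neighbourhood of \<open>X\<close> of radius
  \<open>(1/2) ^ n\<close>: a point of all \<open>?K n\<close> on no segment has distance 0 from
  \<open>X\<close>.\<close>

lemma closed_hull: "closed hull_X" and bounded_hull: "bounded hull_X"
proof -
  let ?K = "\<lambda>n. \<Union>(\<Union>k<n. segs k) \<union> {z. infdist z X \<le> (1/2) ^ n}"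
  have near: "infdist z X \<le> (1/2) ^ n" if z: "z \<in> A" "A \<in> segs k" and nk: "n \<le> k" for z A n k
  proof -
    obtain q where q: "q \<in> P (Suc k)" "A = closed_segment q (r k q)"
      using z by (auto simp: segs_def)
    then have "q \<in> X" using P_subset by blast
    then have "infdist z X \<le> dist z q" by (rule infdist_le)
    also have "\<dots> \<le> dist q (r k q)"
      using z q by (metis dist_in_closed_segment(1))
    also have "\<dots> \<le> (1/2) ^ k" by (rule dist_r[OF \<open>q \<in> X\<close>])
    also have "\<dots> \<le> (1/2) ^ n" using nk by (simp add: power_decreasing)
    finally show ?thesis .
  qed
  have sub: "hull_X \<subseteq> ?K n" for n
  proof
    fix z assume "z \<in> hull_X"
    then consider "z \<in> X" | k A where "A \<in> segs k" "z \<in> A"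
      by (auto simp: hull_X_def)
    then show "z \<in> ?K n"
    proof cases
      case 2
      then show ?thesis using near[of z A k n] by (cases "n \<le> k") (auto simp: not_le)
    qed (auto simp: infdist_zero)
  qed
  have "(\<Inter>n. ?K n) \<subseteq> hull_X"
  proof
    fix z assume z: "z \<in> (\<Inter>n. ?K n)"
    show "z \<in> hull_X"
    proof (cases "z \<in> \<Union>(\<Union>n. segs n)")
      case False
      with z have le: "infdist z X \<le> (1/2) ^ n" for n by blast
      have "infdist z X \<le> 0"
      proof (rule LIMSEQ_le_const)
        show "(\<lambda>n. (1/2::real) ^ n) \<longlonglongrightarrow> 0" by (rule LIMSEQ_power_zero) simp
      qed (use le in blast)
      then have "z \<in> X"
        using closed_X nonempty_X infdist_nonneg[of z X] in_closed_iff_infdist_zero by fastforce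
      then show ?thesis by (simp add: hull_X_def)
    qed (auto simp: hull_X_def)
  qed
  then have eq: "hull_X = (\<Inter>n. ?K n)" using sub by blast
  have "compact {z. infdist z X \<le> (1/2) ^ n}" for n
    by (rule compact_infdist_le) (use nonempty_X compact_X in auto)
  then have "closed (?K n)" for n
    by (intro closed_Un closed_Union) (auto simp: finite_segs closed_segs compact_imp_closed)
  then show "closed hull_X" unfolding eq by blast
  \<comment> \<open>This neighbourhood is \<open>?K 0\<close>, which includes no segments.\<close>
  have "bounded {z. infdist z X \<le> 1}"
    by (rule compact_imp_bounded, rule compact_infdist_le) (use nonempty_X compact_X in auto)
  then show "bounded hull_X"
    using sub[of 0] by (auto intro: bounded_subset)
qed

text \<open>Segments of level at least \<open>n\<close> lie in the trees. The points of
  \<open>X\<close> are then reached as limits of segment ends, because the right-hand side is a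
  finite union of closed sets.\<close>

lemma hull_cover:
  "hull_X = \<Union>((\<Union>k<n. segs k) \<union> (\<lambda>p. closure (\<Union>m. tree m n p)) ` P n)" (is "_ = \<Union>(?S \<union> ?C)")
proof
  have "closure (\<Union>m. tree m n p) \<subseteq> hull_X" if "p \<in> P n" for p
    using that P_subset tree_subset_hull closed_hull by (intro closure_minimal) blast+
  then show "\<Union>(?S \<union> ?C) \<subseteq> hull_X"
    by (auto simp: hull_X_def)
  have segs: "A \<subseteq> \<Union>(?S \<union> ?C)" if A: "A \<in> segs k" for A k
  proof (cases "k < n")
    case False
    then have "A \<in> segs ((k - n) + n)" using A by simp
    from segs_subset_trees[OF this] have "A \<subseteq> (\<Union>p\<in>P n. \<Union>m. tree m n p)" by blast
    also have "\<dots> \<subseteq> (\<Union>p\<in>P n. closure (\<Union>m. tree m n p))"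
      by (intro UN_mono subset_refl closure_subset)
    finally show ?thesis by blast
  qed (use A in blast)
  have closed: "closed (\<Union>(?S \<union> ?C))"
    by (rule closed_Union) (auto simp: finite_segs finite_P closed_segs)
  have "x \<in> \<Union>(?S \<union> ?C)" if x: "x \<in> X" for x
  proof (rule closed_sequentially[OF closed])
    \<comment> \<open>Net points of index \<open>Suc (k + n)\<close> are the finer ends of segments
      of level \<open>k + n\<close>, and they converge to \<open>x\<close>.\<close>
    have "r (Suc (k + n)) x \<in> P (Suc (k + n))" for k
      using x r_in by blast
    then have "closed_segment (r (Suc (k + n)) x) (r (k + n) (r (Suc (k + n)) x)) \<in> segs (k + n)" for k
      by (auto simp: segs_def)
    then show "r (Suc (k + n)) x \<in> \<Union>(?S \<union> ?C)" for k
      using segs ends_in_segment(1) by blast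
    have lim: "(\<lambda>k. (1/2::real) ^ (k + Suc n)) \<longlonglongrightarrow> 0"
      by (intro LIMSEQ_ignore_initial_segment LIMSEQ_power_zero) simp
    have "norm (dist (r (Suc (k + n)) x) x) \<le> (1/2) ^ (k + Suc n)" for k
      using dist_r[OF x, of "Suc (k + n)"] by (simp add: dist_commute)
    then have "\<forall>\<^sub>F k in sequentially. norm (dist (r (Suc (k + n)) x) x) \<le> (1/2) ^ (k + Suc n)"
      by (intro always_eventually allI)
    from Lim_null_comparison[OF this lim]
     show "(\<lambda>k. r (Suc (k + n)) x) \<longlonglongrightarrow> x"
      by (rule iffD2[OF tendsto_dist_iff])
  qed
  then have "X \<subseteq> \<Union>(?S \<union> ?C)"
    by (rule subsetI)
  moreover have "\<Union>(\<Union>k. segs k) \<subseteq> \<Union>(?S \<union> ?C)"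
  proof (rule Union_least)
    fix A assume "A \<in> (\<Union>k. segs k)"
    then obtain k where "A \<in> segs k" by blast
    then show "A \<subseteq> \<Union>(?S \<union> ?C)" by (rule segs)
  qed
  ultimately show "hull_X \<subseteq> \<Union>(?S \<union> ?C)"
    unfolding hull_X_def by (rule Un_least)
qed

lemma locally_connected_hull: "locally connected hull_X"
proof (rule locally_connected_finite_closed_covers)
  fix e :: real assume "e > 0"
  \<comment> \<open>Two points in a ball of radius \<open>2 * (1/2) ^ n\<close> are at most
    \<open>4 * (1/2) ^ n\<close> apart, whence \<open>e / 4\<close>.\<close>
  then obtain n where n: "(1/2::real) ^ n < e / 4"
    using real_arch_pow_inv[of "e / 4" "1/2"] by auto
  let ?\<A> = "(\<Union>k<n. segs k) \<union> (\<lambda>p. closure (\<Union>m. tree m n p)) ` P n"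
  have "closed A \<and> (convex A \<or> connected A \<and> (\<forall>x\<in>A. \<forall>y\<in>A. dist x y < e))" if A: "A \<in> ?\<A>" for A
  proof -
    consider k where "A \<in> segs k" | p where "p \<in> P n" "A = closure (\<Union>m. tree m n p)"
      using A by blast
    then show ?thesis
    proof cases
      case 1
      then show ?thesis by (auto simp: segs_def)
    next
      case 2
      \<comment> \<open>The trees of all depths share the root \<open>p\<close>.\<close>
      have "connected (\<Union>(range (\<lambda>m. tree m n p)))"
        using root_in_tree[of p _ n]
        by (intro connected_Union) (use connected_tree in blast)+
      then have "connected A"
        using 2 connected_imp_connected_closure by blast
      moreover have "A \<subseteq> cball p (2 * (1/2) ^ n)"
        unfolding 2(2) using 2(1) P_subset[of n] tree_subset_cball[of p _ n]
        by (intro closure_minimal) auto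
      then have "dist x y < e" if "x \<in> A" "y \<in> A" for x y
      proof -
        have "dist p x \<le> 2 * (1/2) ^ n" "dist p y \<le> 2 * (1/2) ^ n"
          using that \<open>A \<subseteq> _\<close> by auto
        then show ?thesis
          using n dist_triangle[of x y p] dist_commute[of x p] by linarith
      qed
      ultimately show ?thesis using 2 by blast
    qed
  qed
  moreover have "finite ?\<A>"
    by (simp add: finite_segs finite_P)
  ultimately show "\<exists>\<A>. finite \<A> \<and> \<Union>\<A> = hull_X \<and>
      (\<forall>A\<in>\<A>. closed A \<and> (convex A \<or> connected A \<and> (\<forall>x\<in>A. \<forall>y\<in>A. dist x y < e)))"
    using hull_cover[of n, symmetric] by blast
qed

text \<open>Each segment has its ends in \<open>X\<close>, so adding it to \<open>X\<close> keeps
  the set connected, and all these enlargements have \<open>X\<close> in common.\<close>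

lemma connected_hull:
  assumes "connected X"
  shows "connected hull_X"
proof -
  let ?\<B> = "insert X (\<Union>n. (\<union>) X ` segs n)"
  have XA: "connected (X \<union> A)" if "A \<in> segs n" for A n
    using that assms P_subset[of "Suc n"] unfolding segs_def
    by (auto intro!: connected_Un)
  have "connected (\<Union>?\<B>)"
  proof (rule connected_Union)
    have "X \<subseteq> \<Inter>?\<B>" by blast
    then show "\<Inter>?\<B> \<noteq> {}" using nonempty_X by blast
  qed (use assms XA in blast)
  moreover have "hull_X = \<Union>?\<B>"
    by (auto simp: hull_X_def)
  ultimately show ?thesis by simp
qed

lemma suslinian_hull:
  assumes "suslinian X"
  shows "suslinian hull_X"
proof -
  have "hull_X = \<Union>(insert X (\<Union>n. segs n))"
    by (auto simp: hull_X_def)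
  moreover have "suslinian \<dots>"
  proof (rule suslinian_countable_Union)
    show "countable (insert X (\<Union>n. segs n))"
      by (auto simp: finite_segs countable_finite)
  qed (use assms closed_X closed_segs suslinian_closed_segment in \<open>auto simp: segs_def\<close>)
  ultimately show ?thesis by simp
qed

end

section \<open>Existence of the nets and conclusion\<close>

lemma nested_nets_exist:
  fixes X :: "'a::euclidean_space set"
  assumes "compact X" "X \<noteq> {}"
  obtains P r where "nested_nets X P r"
proof -
  have "\<exists>K. finite K \<and> K \<subseteq> X \<and> X \<subseteq> (\<Union>p\<in>K. ball p ((1/2) ^ n))" for n :: nat
    using seq_compact_imp_totally_bounded[of X] assms(1)
    by (simp add: compact_eq_seq_compact_metric)
  then obtain P where P: "\<And>n. finite (P n)" "\<And>n. P n \<subseteq> X"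
    "\<And>n. X \<subseteq> (\<Union>p\<in>P n. ball p ((1/2) ^ n))"
    by metis
  \<comment> \<open>Placing \<open>x \<in> X\<close> inside the existential makes the claim hold for
    every \<open>x\<close>, so that choice yields a total function \<open>r n\<close>.\<close>
  have "\<exists>p. x \<in> X \<longrightarrow> p \<in> P n \<and> dist x p \<le> (1/2) ^ n" for n x
    using P(3)[of n] by (fastforce simp: dist_commute)
  then have "\<exists>r. \<forall>n x. x \<in> X \<longrightarrow> r n x \<in> P n \<and> dist x (r n x) \<le> (1/2) ^ n"
    by (intro choice allI)
  then obtain r where "\<And>n x. x \<in> X \<Longrightarrow> r n x \<in> P n \<and> dist x (r n x) \<le> (1/2) ^ n"
    by blast
  then have "nested_nets X P r"
    using assms P by unfold_locales auto
  then show thesis by (rule that)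
qed

theorem theorem6:
  fixes X :: "(real^2) set"
  assumes "continuum X" and "suslinian X"
  shows "\<exists>X' :: (real^2) set. X \<subseteq> X' \<and> continuum X' \<and> locally connected X' \<and> suslinian X'"
proof -
  have X: "compact X" "X \<noteq> {}" "connected X"
    using assms(1) by (auto simp: continuum_def)
  then obtain P r where "nested_nets X P r"
    using nested_nets_exist by blast
  then interpret nested_nets X P r .
  have "X \<subseteq> hull_X"
    by (auto simp: hull_X_def)
  moreover have "continuum hull_X"
    using X closed_hull bounded_hull connected_hull \<open>X \<subseteq> hull_X\<close>
    by (auto simp: continuum_def compact_eq_bounded_closed)
  ultimately show ?thesis
    using locally_connected_hull suslinian_hull[OF assms(2)] by blast
qed

end
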